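(* Let $m,\ell\ge 1$ be integers, let $X=\{x_0,x_1,\dots,x_m\}$, and let $\mathfrak p,\mathfrak q\in[1,\infty]$ be conjugate exponents, i.e. $1/\mathfrak p+1/\mathfrak q=1$. The map $$L_{\mathfrak p}^m(0)\times \mathbb{R}^{\ell}_{LC}\langle\langle X\rangle\rangle\rightarrow L_{\mathfrak q}^{\ell}(0),\qquad (u,c)\mapsto y=F_c[u]$$ is well defined. Moreover, for every $M>0$ and every fixed $u\in L_{\mathfrak p}^m(0)$, there exists a $T>0$ such that the map $$\ell_{\infty,M}(X^*,\mathbb{R}^\ell)\rightarrow L_{\mathfrak q}^{\ell}[0,T],\qquad c\mapsto y=F_c[u]$$ is continuous (with respect to the norm $\|\cdot\|_{\ell_{\infty,M}}$ and the $L_{\mathfrak q}$-norm).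
   Context: Words and series: $X=\{x_0,\dots,x_m\}$ is a finite set of noncommuting letters; $X^*$ is the set of all finite words over $X$, including the empty word $\emptyset$; $|\eta|$ is the length of the word $\eta$ (with $|\emptyset|=0$). A formal power series is any map $c:X^*\to\mathbb{R}^\ell$, written $c=\sum_{\eta\in X^*}(c,\eta)\,\eta$, where $(c,\eta)\in\mathbb{R}^\ell$ is the value of $c$ at $\eta$; the set of all of these is $\mathbb{R}^\ell\langle\langle X\rangle\rangle$. For $z\in\mathbb{R}^\ell$, $|z|:=\max_i|z_i|$. Locally convergent series: $\mathbb{R}^\ell_{LC}\langle\langle X\rangle\rangle$ is the set of all $c\in\mathbb{R}^\ell\langle\langle X\rangle\rangle$ for which there exist real numbers $K\ge 0$, $M>0$ with $|(c,\eta)|\le K M^{|\eta|}\,|\eta|!$ for all $\eta\in X^*$. The Banach space $\ell_{\infty,M}(X^*,\mathbb{R}^\ell)$: for fixed $M>0$ put $\|c\|_{\ell_{\infty,M}}:=\sup\{|(c,\eta)|/(M^{|\eta|}|\eta|!):\eta\in X^*\}\in[0,\infty]$; then $\ell_{\infty,M}(X^*,\mathbb{R}^\ell)$ is the set of all $c\in\mathbb{R}^\ell\langle\langle X\rangle\rangle$ with $\|c\|_{\ell_{\infty,M}}<\infty$, normed by $\|\cdot\|_{\ell_{\infty,M}}$. Input and output spaces: for a measurable $u=(u_1,\dots,u_m):[t_0,t_1]\to\mathbb{R}^m$, $\|u\|_{\mathfrak p}:=\max_{1\le i\le m}\|u_i\|_{\mathfrak p}$, where $\|u_i\|_{\mathfrak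 p}$ is the usual $L_{\mathfrak p}$-norm on $[t_0,t_1]$; $L^m_{\mathfrak p}[t_0,t_1]$ is the space of measurable $u$ with $\|u\|_{\mathfrak p}<\infty$. The spaces $L^\ell_{\mathfrak q}[t_0,t_1]$ are defined analogously. The space of germs is $L^m_{\mathfrak p}(t_0):=\{[u] : u\in L^m_{\mathfrak p}[t_0,t_1]\text{ for some }t_1>t_0\}$, where the class $[u]$ contains all functions equal to $u$ in some neighborhood of $t_0$ (in the domain $t\ge t_0$); $L^\ell_{\mathfrak q}(t_0)$ is defined analogously. A germ is denoted by the same symbol as a representative. Iterated integrals and Chen-Fliess series: for $u\in L_1^m[t_0,t_1]$ set $u_0:=1$, $E_\emptyset[u]:=1$, and inductively for $x_i\in X$, $\bar\eta\in X^*$, $$E_{x_i\bar\eta}[u](t,t_0):=\int_{t_0}^t u_i(\tau)\,E_{\bar\eta}[u](\tau,t_0)\,d\tau .$$ The Chen-Fliess series of $c$ is $F_c[u](t):=\sum_{\eta\in X^*}(c,\eta)\,E_\eta[u](t,t_0)$; here $t_0=0$. Meaning of "well defined": for a representative $u$ of the input germ, the series $F_c[u]$ converges on $[0,T]$ for some $T>0$ to a function in $L^\ell_{\mathfrak q}[0,T]$, whose germ at $0$ depends only on the germ of $u$ and on $c$. In the second assertion, $T$ may depend on $M$ and $u$, and $F_c[u]$ is computed on $[0,T]$ from a representative of $u$ defined on $[0,T]$. *)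

theory Defs
  imports "HOL-Analysis.Analysis" "HOL-Probability.Essential_Supremum"
begin

text \<open>
  The index types \<open>'m\<close> and \<open>'l\<close> have \<open>m\<close> and \<open>\<ell>\<close> elements. The alphabet
  \<open>X = {x\<^sub>0, x\<^sub>1, \<dots>, x\<^sub>m}\<close> is the type \<open>'m option\<close>: \<open>None\<close> is \<open>x\<^sub>0\<close> and \<open>Some i\<close> is
  \<open>x\<^sub>i\<close>. Words are lists, and the max norm on \<open>\<real>\<^sup>\<ell>\<close> is \<^const>\<open>infnorm\<close>.
\<close>

type_synonym 'm word = "'m option list"

type_synonym ('m, 'l) series = "'m word \<Rightarrow> real ^ 'l"

definition LC :: "('m::finite, 'l::finite) series set" where
  "LC = {c. \<exists>K M. 0 \<le> K \<and> 0 < M \<and>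
              (\<forall>\<eta>. infnorm (c \<eta>) \<le> K * M ^ length \<eta> * fact (length \<eta>))}"

definition linf_norm :: "real \<Rightarrow> ('m::finite, 'l::finite) series \<Rightarrow> ennreal" where
  "linf_norm M c = (SUP \<eta>. ennreal (infnorm (c \<eta>) / (M ^ length \<eta> * fact (length \<eta>))))"

definition linf :: "real \<Rightarrow> ('m::finite, 'l::finite) series set" where
  "linf M = {c. linf_norm M c < \<infinity>}"

definition Lp_norm_real :: "ennreal \<Rightarrow> real \<Rightarrow> real \<Rightarrow> (real \<Rightarrow> real) \<Rightarrow> ennreal" where
  "Lp_norm_real p a b f =
     (if p = \<infinity> then esssup (lebesgue_on {a..b}) (\<lambda>t. ennreal \<bar>f t\<bar>)
      else let I = (\<integral>\<^sup>+ t. ennreal (\<bar>f t\<bar> powr enn2real p) \<partial>lebesgue_on {a..b})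
           in if I = \<infinity> then \<infinity> else ennreal (enn2real I powr (1 / enn2real p)))"

definition Lp_norm :: "ennreal \<Rightarrow> real \<Rightarrow> real \<Rightarrow> (real \<Rightarrow> real ^ 'k::finite) \<Rightarrow> ennreal" where
  "Lp_norm p a b u = Max (range (\<lambda>i. Lp_norm_real p a b (\<lambda>t. u t $ i)))"

text \<open>
  Functions on \<open>[a, b]\<close> are total functions whose values outside \<open>{a..b}\<close> play no role.
  There is no quotient by almost everywhere equality.
\<close>

definition Lp :: "ennreal \<Rightarrow> real \<Rightarrow> real \<Rightarrow> (real \<Rightarrow> real ^ 'k::finite) set" where
  "Lp p a b = {u. u \<in> borel_measurable (lebesgue_on {a..b}) \<and> Lp_norm p a b u < \<infinity>}"

definition germ :: "real \<Rightarrow> (real \<Rightarrow> 'b) \<Rightarrow> (real \<Rightarrow> 'b) set" where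
  "germ t0 u = {v. \<exists>d>0. \<forall>t\<in>{t0..<t0 + d}. v t = u t}"

definition Lp_germs :: "ennreal \<Rightarrow> real \<Rightarrow> (real \<Rightarrow> real ^ 'k::finite) set set" where
  "Lp_germs p t0 = {germ t0 u | u. \<exists>t1>t0. u \<in> Lp p t0 t1}"

fun input :: "(real \<Rightarrow> real ^ 'm::finite) \<Rightarrow> 'm option \<Rightarrow> real \<Rightarrow> real" where
  "input u None t = 1"
| "input u (Some i) t = u t $ i"

text \<open>
  The integral is taken over \<^const>\<open>lebesgue\<close>, not \<^const>\<open>lborel\<close>: inputs are only
  Lebesgue measurable, and the Bochner integral of a non-measurable function is \<open>0\<close>.
\<close>

primrec iterated_integral ::
    "'m::finite word \<Rightarrow> (real \<Rightarrow> real ^ 'm) \<Rightarrow> real \<Rightarrow> real \<Rightarrow> real" where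
  "iterated_integral [] u t0 t = 1"
| "iterated_integral (x # \<eta>) u t0 t =
     set_lebesgue_integral lebesgue {t0..t} (\<lambda>\<tau>. input u x \<tau> * iterated_integral \<eta> u t0 \<tau>)"

definition CF_term ::
    "('m::finite, 'l::finite) series \<Rightarrow> (real \<Rightarrow> real ^ 'm) \<Rightarrow> real \<Rightarrow> 'm word \<Rightarrow> real ^ 'l" where
  "CF_term c u t \<eta> = iterated_integral \<eta> u 0 t *\<^sub>R c \<eta>"

text \<open>
  The sum over the unordered index set \<open>X\<^sup>*\<close> is unconditional (equivalently, as \<open>\<real>\<^sup>\<ell>\<close> is
  finite-dimensional, absolute); where it does not converge, \<^const>\<open>infsum\<close> returns \<open>0\<close>,
  so convergence is asserted separately.
\<close>

definition CF_converges_on ::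
    "real set \<Rightarrow> ('m::finite, 'l::finite) series \<Rightarrow> (real \<Rightarrow> real ^ 'm) \<Rightarrow> bool" where
  "CF_converges_on S c u \<longleftrightarrow> (\<forall>t\<in>S. CF_term c u t summable_on UNIV)"

definition CF ::
    "('m::finite, 'l::finite) series \<Rightarrow> (real \<Rightarrow> real ^ 'm) \<Rightarrow> real \<Rightarrow> real ^ 'l" where
  "CF c u t = (\<Sum>\<^sub>\<infinity>\<eta>. CF_term c u t \<eta>)"

text \<open>
  Continuity of \<open>F\<close> on the set \<open>S\<close> of functions with respect to the distances \<open>N (d - c)\<close>
  and \<open>N' (F d - F c)\<close>. Stated through the extended-valued norms themselves, since these are
  not the norms of a type.
\<close>

definition norm_continuous_on ::
    "('a \<Rightarrow> 'b::minus) set \<Rightarrow> (('a \<Rightarrow> 'b) \<Rightarrow> ennreal) \<Rightarrow> (('s \<Rightarrow> 'd::minus) \<Rightarrow> ennreal) \<Rightarrow>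
     (('a \<Rightarrow> 'b) \<Rightarrow> ('s \<Rightarrow> 'd)) \<Rightarrow> bool" where
  "norm_continuous_on S N N' F \<longleftrightarrow>
     (\<forall>c\<in>S. \<forall>\<epsilon>::real>0. \<exists>\<delta>::real>0. \<forall>d\<in>S.
        N (\<lambda>x. d x - c x) < ennreal \<delta> \<longrightarrow> N' (\<lambda>s. F d s - F c s) < ennreal \<epsilon>)"

end

theory Submission
  imports Defs
begin

text \<open>
  Everything rests on one estimate. On a compact interval an \<open>L\<^sub>p\<close> input is integrable, so
  \<open>S(t) = \<integral>\<^sub>0\<^sup>t (1 + \<bar>u\<^sub>1\<bar> + \<dots> + \<bar>u\<^sub>m\<bar>)\<close> is finite, continuous and vanishes at \<open>0\<close>. The
  iterated integrals of all words of length \<open>n\<close> together satisfy \<open>\<Sum> \<bar>E\<^sub>\<eta>(t)\<bar> \<le> S(t)\<^sup>n / n!\<close>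
  (\<open>sum_abs_iterated_integral_le\<close>), by induction on \<open>n\<close> from \<open>\<integral> S\<^sup>n dS \<le> S\<^sup>n\<^sup>+\<^sup>1 / (n + 1)\<close>
  (\<open>integral_mult_power_primitive_le\<close>).

  Coefficients bounded by \<open>K M\<^sup>n n!\<close> therefore give a series dominated by \<open>K \<Sum> (M S(t))\<^sup>n\<close>.
  Choosing \<open>T\<close> with \<open>M S(T) \<le> 1/2\<close>, the series converges absolutely on \<open>[0, T]\<close> and its sum
  is bounded by \<open>2 K\<close> up to a constant comparing the norms of \<open>\<real>\<^sup>\<ell>\<close> (\<open>CF_horizon\<close>). A bounded
  measurable function on \<open>[0, T]\<close> is in every \<open>L\<^sub>q\<close>. Since \<open>T\<close> depends only on \<open>M\<close> and \<open>u\<close> and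
  the series is linear in its coefficients, the same bound applied to the difference of two
  series shows that \<open>c \<mapsto> F\<^sub>c[u]\<close> is Lipschitz. The germ of the output is determined by the germ of
  the input because an iterated integral at time \<open>t\<close> sees the input only on \<open>[0, t]\<close>.
\<close>

section \<open>Powers of a primitive\<close>

lemma power_mult_diff_le:
  fixes x y :: real
  assumes "0 \<le> x" "x \<le> y"
  shows "x ^ n * (y - x) \<le> (y ^ Suc n - x ^ Suc n) / Suc n"
proof -
  have "real (Suc n) * (x ^ n * (y - x)) \<le> y ^ Suc n - x ^ Suc n"
  proof (induction n)
    case (Suc n)
    have "real (Suc (Suc n)) * (x ^ Suc n * (y - x))
        = x * (real (Suc n) * (x ^ n * (y - x))) + x ^ Suc n * (y - x)"
      by (simp add: algebra_simps)
    also have "\<dots> \<le> x * (y ^ Suc n - x ^ Suc n) + x ^ Suc n * (y - x)"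
      using Suc assms by (intro add_right_mono mult_left_mono) auto
    also have "\<dots> \<le> y * (y ^ Suc n - x ^ Suc n) + x ^ Suc n * (y - x)"
      using assms power_mono[of x y "Suc n"] by (intro add_right_mono mult_right_mono) auto
    also have "\<dots> = y ^ Suc (Suc n) - x ^ Suc (Suc n)"
      by (simp add: algebra_simps)
    finally show ?case .
  qed simp
  then show ?thesis
    by (simp add: field_simps del: of_nat_Suc)
qed

text \<open>
  A form of the fundamental theorem for \<open>dh \<le> S\<^sup>n dS\<close> that asks for no differentiability of \<open>S\<close>:
  with an arbitrarily small slope \<open>e\<close> to spare, the inequality holds on short intervals, and
  it is additive over adjacent intervals.
\<close>

lemma increment_le_power_increment:
  fixes S h :: "real \<Rightarrow> real"
  assumes "a \<le> b" and cont: "continuous_on {a..b} S" and mono: "mono_on {a..b} S"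
    and nonneg: "\<And>x. x \<in> {a..b} \<Longrightarrow> 0 \<le> S x"
    and incr: "\<And>x y. a \<le> x \<Longrightarrow> x \<le> y \<Longrightarrow> y \<le> b \<Longrightarrow> h y - h x \<le> S y ^ n * (S y - S x)"
  shows "h b - h a \<le> (S b ^ Suc n - S a ^ Suc n) / Suc n"
proof (rule field_le_epsilon)
  define F where "F x = S x ^ Suc n / Suc n" for x
  have F_diff: "S x ^ n * (S y - S x) \<le> F y - F x" if "a \<le> x" "x \<le> y" "y \<le> b" for x y
    using power_mult_diff_le[of "S x" "S y" n] nonneg mono_onD[OF mono, of x y] that
    by (simp add: F_def diff_divide_distrib)
  fix \<epsilon> :: real assume "\<epsilon> > 0"
  have Sab: "S a \<le> S b"
    using mono_onD[OF mono, of a b] \<open>a \<le> b\<close> by auto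
  define e where "e = \<epsilon> / (S b - S a + 1)"
  have "e > 0"
    using \<open>\<epsilon> > 0\<close> Sab by (simp add: e_def)
  define P where "P x y \<longleftrightarrow>
    (a \<le> x \<and> x \<le> y \<and> y \<le> b \<longrightarrow> h y - h x \<le> F y - F x + e * (S y - S x))" for x y
  have "P a b"
    using \<open>a \<le> b\<close>
  proof (induction rule: Bolzano)
    case (trans x y z)
    then show ?case
      by (auto simp: P_def algebra_simps)
  next
    case (local x)
    have "continuous_on {a..b} (\<lambda>s. S s ^ n)"
      by (intro continuous_intros cont)
    then obtain d where "d > 0"
      and d: "\<And>y. y \<in> {a..b} \<Longrightarrow> \<bar>y - x\<bar> < d \<Longrightarrow> \<bar>S y ^ n - S x ^ n\<bar> < e / 2"
      using \<open>e > 0\<close> local unfolding continuous_on_iff dist_real_def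
      by (metis atLeastAtMost_iff half_gt_zero)
    have "P y z" if yz: "y \<le> x" "x \<le> z" "z - y < d" for y z
      unfolding P_def
    proof (intro impI)
      assume *: "a \<le> y \<and> y \<le> z \<and> z \<le> b"
      have "\<bar>S y ^ n - S x ^ n\<bar> < e / 2" "\<bar>S z ^ n - S x ^ n\<bar> < e / 2"
        using d[of y] d[of z] * yz by auto
      then have "S z ^ n \<le> S y ^ n + e"
        by linarith
      moreover have "S y \<le> S z"
        using mono_onD[OF mono, of y z] * by auto
      ultimately have "S z ^ n * (S z - S y) \<le> (S y ^ n + e) * (S z - S y)"
        by (intro mult_right_mono) auto
      then show "h z - h y \<le> F z - F y + e * (S z - S y)"
        using incr[of y z] F_diff[of y z] * by (simp add: algebra_simps)
    qed
    then show ?case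
      using \<open>d > 0\<close> by auto
  qed
  then have "h b - h a \<le> F b - F a + e * (S b - S a)"
    using \<open>a \<le> b\<close> by (simp add: P_def)
  also have "e * (S b - S a) \<le> \<epsilon>"
    using Sab \<open>\<epsilon> > 0\<close> by (simp add: e_def field_simps)
  finally show "h b - h a \<le> (S b ^ Suc n - S a ^ Suc n) / Suc n + \<epsilon>"
    by (simp add: F_def diff_divide_distrib)
qed

lemma primitive_nonneg_mono:
  fixes w :: "real \<Rightarrow> real"
  assumes int: "w integrable_on {a..b}" and nonneg: "\<And>\<tau>. \<tau> \<in> {a..b} \<Longrightarrow> 0 \<le> w \<tau>"
  shows "mono_on {a..b} (\<lambda>s. integral {a..s} w)"
    and "\<And>s. s \<in> {a..b} \<Longrightarrow> 0 \<le> integral {a..s} w"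
proof -
  have *: "w integrable_on {a..s}" if "s \<in> {a..b}" for s
    using integrable_on_subinterval[OF int, of a s] that by auto
  show "mono_on {a..b} (\<lambda>s. integral {a..s} w)"
    by (intro mono_onI integral_subset_le *) (use nonneg in auto)
  show "0 \<le> integral {a..s} w" if "s \<in> {a..b}" for s
    using that nonneg by (intro integral_nonneg *) auto
qed

lemma absolutely_integrable_continuous_mult:
  fixes f g :: "real \<Rightarrow> real"
  assumes f: "f absolutely_integrable_on {a..b}" and g: "continuous_on {a..b} g"
  shows "(\<lambda>\<tau>. f \<tau> * g \<tau>) absolutely_integrable_on {a..b}"
proof -
  have "(\<lambda>\<tau>. g \<tau> * f \<tau>) absolutely_integrable_on {a..b}"
    by (rule absolutely_integrable_bounded_measurable_product_real[OF _ _ _ f])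
       (use g in \<open>auto intro!: continuous_imp_measurable_on_sets_lebesgue compact_imp_bounded
          compact_continuous_image\<close>)
  then show ?thesis
    by (simp add: mult.commute)
qed

lemma integral_mult_power_primitive_le:
  fixes w :: "real \<Rightarrow> real"
  assumes int: "w absolutely_integrable_on {a..b}" and nonneg: "\<And>\<tau>. \<tau> \<in> {a..b} \<Longrightarrow> 0 \<le> w \<tau>"
    and "a \<le> b"
  defines "S \<equiv> \<lambda>s. integral {a..s} w"
  shows "integral {a..b} (\<lambda>\<tau>. w \<tau> * S \<tau> ^ n) \<le> S b ^ Suc n / Suc n"
proof -
  have w: "w integrable_on {a..b}"
    using int set_lebesgue_integral_eq_integral(1) by blast
  have cont: "continuous_on {a..b} S"
    unfolding S_def by (rule indefinite_integral_continuous_1[OF w])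
  have mono: "mono_on {a..b} S" and S_nonneg: "\<And>s. s \<in> {a..b} \<Longrightarrow> 0 \<le> S s"
    unfolding S_def using primitive_nonneg_mono[OF w nonneg] by auto
  have wS: "(\<lambda>\<tau>. w \<tau> * S \<tau> ^ n) integrable_on {a..b}"
    by (rule set_lebesgue_integral_eq_integral(1)[OF absolutely_integrable_continuous_mult[OF int]])
       (intro continuous_intros cont)
  define h where "h s = integral {a..s} (\<lambda>\<tau>. w \<tau> * S \<tau> ^ n)" for s
  have "h y - h x \<le> S y ^ n * (S y - S x)" if xy: "a \<le> x" "x \<le> y" "y \<le> b" for x y
  proof -
    have sub: "f integrable_on {c..d}" if "f integrable_on {a..b}" "a \<le> c" "d \<le> b"
      for f :: "real \<Rightarrow> real" and c d
      using integrable_on_subinterval[OF that(1), of c d] that by auto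
    have "h y - h x = integral {x..y} (\<lambda>\<tau>. w \<tau> * S \<tau> ^ n)"
      unfolding h_def
      using Henstock_Kurzweil_Integration.integral_combine[OF xy(1,2) sub[OF wS order.refl xy(3)]]
      by simp
    also have "\<dots> \<le> integral {x..y} (\<lambda>\<tau>. w \<tau> * S y ^ n)"
    proof (rule integral_le)
      show "w \<tau> * S \<tau> ^ n \<le> w \<tau> * S y ^ n" if "\<tau> \<in> {x..y}" for \<tau>
        using that xy nonneg S_nonneg mono_onD[OF mono, of \<tau> y]
        by (intro mult_left_mono power_mono) auto
    qed (use xy in \<open>auto intro!: sub[OF wS] sub[OF w] integrable_on_mult_left\<close>)
    also have "\<dots> = (S y - S x) * S y ^ n"
      unfolding S_def
      using Henstock_Kurzweil_Integration.integral_combine[OF xy(1,2) sub[OF w order.refl xy(3)]]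
      by simp
    finally show ?thesis
      by (simp add: mult.commute)
  qed
  from increment_le_power_increment[OF \<open>a \<le> b\<close> cont mono S_nonneg this]
  show ?thesis
    by (simp add: h_def S_def)
qed

section \<open>Iterated integrals\<close>

text \<open>The density \<open>1 + \<bar>u\<^sub>1\<bar> + \<dots> + \<bar>u\<^sub>m\<bar>\<close> of an input, summed over the whole alphabet.\<close>

definition input_weight :: "(real \<Rightarrow> real ^ 'm::finite) \<Rightarrow> real \<Rightarrow> real" where
  "input_weight u \<tau> = (\<Sum>x\<in>UNIV. \<bar>input u x \<tau>\<bar>)"

lemma input_weight_nonneg: "0 \<le> input_weight u \<tau>"
  by (simp add: input_weight_def sum_nonneg)

lemma absolutely_integrable_input_weight:
  assumes "\<And>x. input u x absolutely_integrable_on A"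
  shows "input_weight u absolutely_integrable_on A"
  unfolding input_weight_def[abs_def]
  using assms by (intro absolutely_integrable_sum set_integrable_abs) auto

lemma continuous_iterated_integral:
  assumes u: "\<And>x. input u x absolutely_integrable_on {t0..T}"
  shows "continuous_on {t0..T} (iterated_integral \<eta> u t0)"
proof (induction \<eta>)
  case Nil
  have "iterated_integral [] u t0 = (\<lambda>_. 1)"
    by auto
  then show ?case
    by simp
next
  case (Cons x \<eta>)
  let ?f = "\<lambda>\<tau>. input u x \<tau> * iterated_integral \<eta> u t0 \<tau>"
  have f: "?f absolutely_integrable_on {t0..T}"
    by (rule absolutely_integrable_continuous_mult[OF u Cons])
  have "iterated_integral (x # \<eta>) u t0 t = integral {t0..t} ?f" if "t \<in> {t0..T}" for t
    using set_lebesgue_integral_eq_integral(2)[OF absolutely_integrable_on_subinterval[OF f, of t0 t]]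
      that by auto
  moreover have "continuous_on {t0..T} (\<lambda>t. integral {t0..t} ?f)"
    by (rule indefinite_integral_continuous_1[OF set_lebesgue_integral_eq_integral(1)[OF f]])
  ultimately show ?case
    by (metis (no_types, lifting) continuous_on_cong)
qed

text \<open>
  Summing over all words of a given length turns the product of the letters into a power of the
  sum of the letters, so the whole level \<open>n\<close> contributes one factor \<open>1 / n!\<close>.
\<close>

lemma sum_abs_iterated_integral_le:
  fixes u :: "real \<Rightarrow> real ^ 'm::finite"
  assumes u: "\<And>x. input u x absolutely_integrable_on {t0..T}"
    and "t \<in> {t0..T}"
  shows "(\<Sum>\<eta> | length \<eta> = n. \<bar>iterated_integral \<eta> u t0 t\<bar>)
     \<le> integral {t0..t} (input_weight u) ^ n / fact n"
  using \<open>t \<in> {t0..T}\<close>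
proof (induction n arbitrary: t)
  case (Suc n)
  let ?E = "\<lambda>\<eta>. iterated_integral \<eta> u t0" and ?W = "{\<eta> :: 'm word. length \<eta> = n}"
  define S where "S s = integral {t0..s} (input_weight u)" for s
  have u': "input u x absolutely_integrable_on {t0..t}" for x
    using absolutely_integrable_on_subinterval[OF u] Suc.prems by auto
  have uE: "(\<lambda>\<tau>. input u x \<tau> * ?E \<eta> \<tau>) absolutely_integrable_on {t0..t}" for x \<eta>
    by (intro absolutely_integrable_continuous_mult u' continuous_iterated_integral)
  have abs_uE: "(\<lambda>\<tau>. \<bar>input u x \<tau> * ?E \<eta> \<tau>\<bar>) integrable_on {t0..t}" for x \<eta>
    by (intro set_lebesgue_integral_eq_integral(1) set_integrable_abs uE)
  have w: "input_weight u absolutely_integrable_on {t0..t}"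
    by (rule absolutely_integrable_input_weight[OF u'])
  have fin: "finite ?W"
    using finite_lists_length_eq[of "UNIV :: 'm option set" n] by simp
  have words: "{\<eta>. length \<eta> = Suc n} = (\<lambda>(x, \<eta>). x # \<eta>) ` (UNIV \<times> ?W)"
    by (auto simp: image_iff length_Suc_conv)
  have "(\<Sum>\<eta> | length \<eta> = Suc n. \<bar>?E \<eta> t\<bar>) = (\<Sum>(x, \<eta>)\<in>UNIV \<times> ?W. \<bar>?E (x # \<eta>) t\<bar>)"
    unfolding words by (subst sum.reindex) (auto simp: inj_on_def case_prod_unfold)
  also have "\<dots> \<le> (\<Sum>(x, \<eta>)\<in>UNIV \<times> ?W. integral {t0..t} (\<lambda>\<tau>. \<bar>input u x \<tau> * ?E \<eta> \<tau>\<bar>))"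
  proof (rule sum_mono, clarify)
    fix x :: "'m option" and \<eta> :: "'m word"
    have "?E (x # \<eta>) t = integral {t0..t} (\<lambda>\<tau>. input u x \<tau> * ?E \<eta> \<tau>)"
      using set_lebesgue_integral_eq_integral(2)[OF uE] by simp
    then show "\<bar>?E (x # \<eta>) t\<bar> \<le> integral {t0..t} (\<lambda>\<tau>. \<bar>input u x \<tau> * ?E \<eta> \<tau>\<bar>)"
      using integral_norm_bound_integral[OF set_lebesgue_integral_eq_integral(1)[OF uE] abs_uE]
      by simp
  qed
  also have "\<dots> = integral {t0..t} (\<lambda>\<tau>. \<Sum>(x, \<eta>)\<in>UNIV \<times> ?W. \<bar>input u x \<tau> * ?E \<eta> \<tau>\<bar>)"
    unfolding case_prod_unfold using fin by (subst integral_sum) (auto intro!: abs_uE)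
  also have "\<dots> = integral {t0..t} (\<lambda>\<tau>. input_weight u \<tau> * (\<Sum>\<eta>\<in>?W. \<bar>?E \<eta> \<tau>\<bar>))"
    by (simp add: input_weight_def sum_product sum.cartesian_product abs_mult)
  also have "\<dots> \<le> integral {t0..t} (\<lambda>\<tau>. input_weight u \<tau> * S \<tau> ^ n * (1 / fact n))"
  proof (rule integral_le)
    show "(\<lambda>\<tau>. input_weight u \<tau> * (\<Sum>\<eta>\<in>?W. \<bar>?E \<eta> \<tau>\<bar>)) integrable_on {t0..t}"
      by (intro set_lebesgue_integral_eq_integral(1) absolutely_integrable_continuous_mult w
          continuous_intros continuous_iterated_integral u')
    have "continuous_on {t0..t} S"
      unfolding S_def
      by (intro indefinite_integral_continuous_1 set_lebesgue_integral_eq_integral(1) w)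
    then show "(\<lambda>\<tau>. input_weight u \<tau> * S \<tau> ^ n * (1 / fact n)) integrable_on {t0..t}"
      by (intro integrable_on_mult_left set_lebesgue_integral_eq_integral(1)
          absolutely_integrable_continuous_mult w continuous_intros)
    fix \<tau> assume "\<tau> \<in> {t0..t}"
    then have "(\<Sum>\<eta>\<in>?W. \<bar>?E \<eta> \<tau>\<bar>) \<le> S \<tau> ^ n / fact n"
      unfolding S_def using Suc.prems by (intro Suc.IH) auto
    from mult_left_mono[OF this input_weight_nonneg[of u \<tau>]]
    show "input_weight u \<tau> * (\<Sum>\<eta>\<in>?W. \<bar>?E \<eta> \<tau>\<bar>) \<le> input_weight u \<tau> * S \<tau> ^ n * (1 / fact n)"
      by simp
  qed
  also have "\<dots> = integral {t0..t} (\<lambda>\<tau>. input_weight u \<tau> * S \<tau> ^ n) * (1 / fact n)"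
    by (rule integral_mult_left)
  also have "\<dots> \<le> S t ^ Suc n / Suc n * (1 / fact n)"
    unfolding S_def
    by (intro mult_right_mono integral_mult_power_primitive_le w input_weight_nonneg)
       (use Suc.prems in auto)
  also have "\<dots> = integral {t0..t} (input_weight u) ^ Suc n / fact (Suc n)"
    by (simp add: S_def)
  finally show ?case .
qed simp

lemma iterated_integral_cong:
  assumes "\<And>\<tau>. \<tau> \<in> {t0..t} \<Longrightarrow> u \<tau> = v \<tau>"
  shows "iterated_integral \<eta> u t0 t = iterated_integral \<eta> v t0 t"
  using assms
proof (induction \<eta> arbitrary: t)
  case (Cons x \<eta>)
  have "input u x \<tau> = input v x \<tau>" if "\<tau> \<in> {t0..t}" for \<tau>
    using Cons.prems[OF that] by (cases x) auto
  moreover have "iterated_integral \<eta> u t0 \<tau> = iterated_integral \<eta> v t0 \<tau>" if "\<tau> \<in> {t0..t}" for \<tau>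
    using that by (intro Cons.IH Cons.prems) auto
  ultimately show ?case
    by (auto intro!: set_lebesgue_integral_cong)
qed simp

section \<open>Convergence of Chen-Fliess series\<close>

text \<open>
  The factorial in the growth bound of the coefficients cancels against the one in the bound on
  the iterated integrals, so level \<open>n\<close> is dominated by \<open>K (M S)\<^sup>n \<le> K / 2\<^sup>n\<close>.
\<close>

lemma CF_bound:
  fixes u :: "real \<Rightarrow> real ^ 'm::finite" and c :: "('m, 'l::finite) series"
  assumes u: "\<And>x. input u x absolutely_integrable_on {0..T}"
    and c: "\<And>\<eta>. norm (c \<eta>) \<le> K * M ^ length \<eta> * fact (length \<eta>)"
    and "0 \<le> K" "0 < M"
    and small: "M * integral {0..T} (input_weight u) \<le> 1 / 2"
    and t: "t \<in> {0..T}"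
  shows "(\<lambda>\<eta>. norm (CF_term c u t \<eta>)) summable_on UNIV"
    and "norm (CF c u t) \<le> 2 * K"
proof -
  let ?h = "\<lambda>\<eta>. norm (CF_term c u t \<eta>)"
  define S where "S = integral {0..t} (input_weight u)"
  have w: "input_weight u integrable_on {0..T}"
    by (intro set_lebesgue_integral_eq_integral(1) absolutely_integrable_input_weight u)
  have "0 \<le> S" "S \<le> integral {0..T} (input_weight u)"
    using primitive_nonneg_mono(2)[OF w input_weight_nonneg, of t]
      mono_onD[OF primitive_nonneg_mono(1)[OF w input_weight_nonneg], of t T] t
    by (auto simp: S_def)
  then have MS: "0 \<le> M * S" and "M * S \<le> M * integral {0..T} (input_weight u)"
    using \<open>0 < M\<close> by (auto intro: mult_left_mono)
  then have "M * S \<le> 1 / 2"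
    using small by linarith
  have level: "(\<Sum>\<eta> | length \<eta> = n. ?h \<eta>) \<le> K * (1 / 2) ^ n" for n
  proof -
    have "(\<Sum>\<eta> | length \<eta> = n. ?h \<eta>)
        \<le> (\<Sum>\<eta> | length \<eta> = n. \<bar>iterated_integral \<eta> u 0 t\<bar> * (K * M ^ n * fact n))"
      using c by (intro sum_mono) (auto simp: CF_term_def intro!: mult_left_mono)
    also have "\<dots> = (\<Sum>\<eta> | length \<eta> = n. \<bar>iterated_integral \<eta> u 0 t\<bar>) * (K * M ^ n * fact n)"
      by (simp add: sum_distrib_right)
    also have "\<dots> \<le> S ^ n / fact n * (K * M ^ n * fact n)"
      unfolding S_def using \<open>0 \<le> K\<close> \<open>0 < M\<close>
      by (intro mult_right_mono sum_abs_iterated_integral_le[OF u t]) auto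
    also have "\<dots> = K * (M * S) ^ n"
      by (simp add: power_mult_distrib)
    also have "\<dots> \<le> K * (1 / 2) ^ n"
      using MS \<open>M * S \<le> 1 / 2\<close> \<open>0 \<le> K\<close> by (intro mult_left_mono power_mono) auto
    finally show ?thesis .
  qed
  have partial: "sum ?h F \<le> 2 * K" if F: "finite F" for F
  proof -
    obtain N where N: "length ` F \<subseteq> {..<N}"
      using finite_imageI[OF F, of length] by (metis finite_nat_iff_bounded)
    have fin: "finite {\<eta> :: 'm word. length \<eta> = n}" for n
      using finite_lists_length_eq[of "UNIV :: 'm option set" n] by simp
    have "sum ?h F = (\<Sum>n<N. sum ?h {\<eta> \<in> F. length \<eta> = n})"
      by (rule sum.group[symmetric]) (use F N in auto)
    also have "\<dots> \<le> (\<Sum>n<N. \<Sum>\<eta> | length \<eta> = n. ?h \<eta>)"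
      by (intro sum_mono sum_mono2 fin) auto
    also have "\<dots> \<le> (\<Sum>n<N. K * (1 / 2) ^ n)"
      by (intro sum_mono level)
    also have "\<dots> = K * (\<Sum>n<N. (1 / 2) ^ n)"
      by (simp add: sum_distrib_left)
    also have "(\<Sum>n<N. (1 / 2 :: real) ^ n) = 2 - 2 * (1 / 2) ^ N"
      by (induction N) auto
    also have "K * (2 - 2 * (1 / 2) ^ N) \<le> K * 2"
      using \<open>0 \<le> K\<close> by (intro mult_left_mono) auto
    finally show ?thesis
      by (simp add: mult.commute)
  qed
  show summable: "?h summable_on UNIV"
    by (rule nonneg_bdd_above_summable_on) (auto intro!: bdd_aboveI[of _ "2 * K"] partial)
  have "norm (CF c u t) \<le> infsum ?h UNIV"
    unfolding CF_def by (rule norm_infsum_bound[OF summable])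
  also have "\<dots> \<le> 2 * K"
    by (rule infsum_le_finite_sums[OF summable partial])
  finally show "norm (CF c u t) \<le> 2 * K" .
qed

text \<open>
  Each word contributes a continuous function of time, and there are only finitely many words
  of length at most \<open>n\<close>; measurability passes to the limit \<open>n \<rightarrow> \<infinity>\<close>.
\<close>

lemma borel_measurable_CF:
  fixes u :: "real \<Rightarrow> real ^ 'm::finite" and c :: "('m, 'l::finite) series"
  assumes u: "\<And>x. input u x absolutely_integrable_on {0..T}"
    and conv: "CF_converges_on {0..T} c u"
  shows "CF c u \<in> borel_measurable (lebesgue_on {0..T})"
proof (rule borel_measurable_LIMSEQ_metric)
  let ?W = "\<lambda>n. {\<eta> :: 'm word. length \<eta> \<le> n}"
  have fin: "finite (?W n)" for n
    using finite_lists_length_le[of "UNIV :: 'm option set" n] by simp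
  show "(\<lambda>t. sum (CF_term c u t) (?W n)) \<in> borel_measurable (lebesgue_on {0..T})" for n
    unfolding CF_term_def
    by (intro continuous_imp_measurable_on_sets_lebesgue continuous_intros
        continuous_iterated_integral u) auto
  show "(\<lambda>n. sum (CF_term c u t) (?W n)) \<longlonglongrightarrow> CF c u t"
    if "t \<in> space (lebesgue_on {0..T})" for t
  proof -
    have "(CF_term c u t has_sum CF c u t) UNIV"
      using conv that unfolding CF_converges_on_def CF_def by auto
    moreover have "filterlim ?W (finite_subsets_at_top UNIV) sequentially"
    proof (unfold filterlim_finite_subsets_at_top, intro allI impI)
      fix X :: "'m word set" assume "finite X \<and> X \<subseteq> UNIV"
      then obtain N where "length ` X \<subseteq> {..N}"
        using finite_imageI[of X length] by (metis finite_nat_iff_bounded_le)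
      then have "X \<subseteq> ?W n" if "n \<ge> N" for n
        using that by force
      then show "\<forall>\<^sub>F n in sequentially. finite (?W n) \<and> X \<subseteq> ?W n \<and> ?W n \<subseteq> UNIV"
        using fin by (auto simp: eventually_sequentially)
    qed
    ultimately show ?thesis
      unfolding has_sum_def by (rule filterlim_compose)
  qed
qed

lemma CF_cong:
  assumes "\<And>\<tau>. \<tau> \<in> {0..t} \<Longrightarrow> u \<tau> = v \<tau>"
  shows "CF c u t = CF c v t"
  using iterated_integral_cong[OF assms] by (simp add: CF_def CF_term_def)

section \<open>Lebesgue spaces on a compact interval\<close>

lemma finite_measure_lebesgue_on_Icc: "finite_measure (lebesgue_on {a..b::real})"
  by (rule finite_measure_lebesgue_on) simp

lemma absolutely_integrable_input:
  fixes u :: "real \<Rightarrow> real ^ 'm::finite"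
  assumes "1 \<le> p" and u: "u \<in> Lp p a b"
  shows "input u x absolutely_integrable_on {a..b}"
proof (cases x)
  case None
  have "input u x = (\<lambda>_. 1)"
    using None by auto
  then show ?thesis
    by (simp add: absolutely_integrable_on_const)
next
  case (Some i)
  define f where "f t = u t $ i" for t
  interpret finite_measure "lebesgue_on {a..b}"
    by (rule finite_measure_lebesgue_on_Icc)
  have f[measurable]: "f \<in> borel_measurable (lebesgue_on {a..b})"
  proof -
    have "(\<lambda>t. u t \<bullet> axis i 1) \<in> borel_measurable (lebesgue_on {a..b})"
      using u by (intro borel_measurable_inner) (auto simp: Lp_def)
    then show ?thesis
      by (simp add: f_def[abs_def] inner_axis)
  qed
  have "Lp_norm_real p a b f \<le> Lp_norm p a b u"
    unfolding Lp_norm_def f_def[abs_def] by (intro Max_ge) auto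
  then have fin: "Lp_norm_real p a b f < \<infinity>"
    using u by (auto simp: Lp_def)
  have "integrable (lebesgue_on {a..b}) f"
  proof (cases "p = \<infinity>")
    case True
    let ?C = "esssup (lebesgue_on {a..b}) (\<lambda>t. ennreal \<bar>f t\<bar>)"
    have C: "?C < \<infinity>"
      using fin True by (simp add: Lp_norm_real_def)
    have "AE t in lebesgue_on {a..b}. norm (f t) \<le> enn2real ?C"
      using esssup_AE[of "\<lambda>t. ennreal \<bar>f t\<bar>" "lebesgue_on {a..b}"]
    proof eventually_elim
      case (elim t)
      from enn2real_mono[OF this] C show ?case
        by simp
    qed
    then show ?thesis
      by (rule integrable_const_bound) simp
  next
    case False
    define r where "r = enn2real p"
    have "enn2real 1 \<le> enn2real p"
      using \<open>1 \<le> p\<close> False by (intro enn2real_mono) (auto simp: less_top)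
    then have "1 \<le> r"
      by (simp add: r_def)
    have I: "(\<integral>\<^sup>+ t. ennreal (\<bar>f t\<bar> powr r) \<partial>lebesgue_on {a..b}) < \<infinity>"
      using fin False by (auto simp: Lp_norm_real_def Let_def r_def less_top split: if_splits)
    \<comment> \<open>The constant \<open>1\<close> is integrable because the interval has finite length.\<close>
    have "\<bar>y\<bar> \<le> 1 + \<bar>y\<bar> powr r" for y :: real
    proof (cases "\<bar>y\<bar> \<le> 1")
      case False
      then have "\<bar>y\<bar> powr 1 \<le> \<bar>y\<bar> powr r"
        using \<open>1 \<le> r\<close> by (intro powr_mono) auto
      then show ?thesis
        using False by simp
    qed (simp add: add_increasing2)
    then have "(\<integral>\<^sup>+ t. ennreal (norm (f t)) \<partial>lebesgue_on {a..b})
        \<le> (\<integral>\<^sup>+ t. 1 + ennreal (\<bar>f t\<bar> powr r) \<partial>lebesgue_on {a..b})"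
      by (intro nn_integral_mono) (simp flip: ennreal_1 ennreal_plus)
    also have "\<dots> = emeasure (lebesgue_on {a..b}) {a..b}
        + (\<integral>\<^sup>+ t. ennreal (\<bar>f t\<bar> powr r) \<partial>lebesgue_on {a..b})"
      by (subst nn_integral_add) auto
    also have "\<dots> < \<infinity>"
      using I emeasure_finite[of "{a..b}"] by (simp add: less_top[symmetric])
    finally show ?thesis
      by (intro integrableI_bounded) auto
  qed
  then have "f absolutely_integrable_on {a..b}"
    by (simp add: set_integrable_def integrable_restrict_space)
  moreover have "input u x = f"
    using Some by (auto simp: f_def)
  ultimately show ?thesis
    by simp
qed

lemma Lp_norm_le_bound:
  fixes f :: "real \<Rightarrow> real ^ 'k::finite"
  assumes "1 \<le> q" and "0 \<le> T" "T \<le> 1"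
    and f: "f \<in> borel_measurable (lebesgue_on {0..T})"
    and B: "\<And>t. t \<in> {0..T} \<Longrightarrow> norm (f t) \<le> B"
  shows "Lp_norm q 0 T f \<le> ennreal B"
proof -
  have "0 \<le> B"
    using order_trans[OF norm_ge_zero B[of 0]] \<open>0 \<le> T\<close> by simp
  have "Lp_norm_real q 0 T (\<lambda>t. f t $ i) \<le> ennreal B" for i
  proof -
    define g where "g t = f t $ i" for t
    have g[measurable]: "g \<in> borel_measurable (lebesgue_on {0..T})"
    proof -
      have "(\<lambda>t. f t \<bullet> axis i 1) \<in> borel_measurable (lebesgue_on {0..T})"
        using f by (intro borel_measurable_inner) auto
      then show ?thesis
        by (simp add: g_def[abs_def] inner_axis)
    qed
    have gB: "\<bar>g t\<bar> \<le> B" if "t \<in> {0..T}" for t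
      using component_le_norm_cart[of "f t" i] B[OF that] by (simp add: g_def)
    have "Lp_norm_real q 0 T g \<le> ennreal B"
    proof (cases "q = \<infinity>")
      case True
      have "esssup (lebesgue_on {0..T}) (\<lambda>t. ennreal \<bar>g t\<bar>) \<le> ennreal B"
        by (rule esssup_I) (auto intro!: AE_I2 ennreal_leI gB)
      then show ?thesis
        using True by (simp add: Lp_norm_real_def)
    next
      case False
      define r where "r = enn2real q"
      define I where "I = (\<integral>\<^sup>+ t. ennreal (\<bar>g t\<bar> powr r) \<partial>lebesgue_on {0..T})"
      have "enn2real 1 \<le> enn2real q"
        using \<open>1 \<le> q\<close> False by (intro enn2real_mono) (auto simp: less_top)
      then have "1 \<le> r"
        by (simp add: r_def)
      have "I \<le> (\<integral>\<^sup>+ t. ennreal (B powr r) \<partial>lebesgue_on {0..T})"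
        unfolding I_def using gB \<open>1 \<le> r\<close>
        by (intro nn_integral_mono ennreal_leI powr_mono2) auto
      also have "\<dots> = ennreal (B powr r) * ennreal T"
        using \<open>0 \<le> T\<close> by (simp add: emeasure_restrict_space)
      also have "\<dots> \<le> ennreal (B powr r) * 1"
        using \<open>T \<le> 1\<close> by (intro mult_left_mono) (auto simp flip: ennreal_1 intro!: ennreal_leI)
      finally have I: "I \<le> ennreal (B powr r)"
        by simp
      then have "I \<noteq> \<infinity>"
        using neq_top_trans[of "ennreal (B powr r)" I] by simp
      have "enn2real I \<le> B powr r"
        using enn2real_mono[OF I] by simp
      then have "enn2real I powr (1 / r) \<le> (B powr r) powr (1 / r)"
        using \<open>1 \<le> r\<close> by (intro powr_mono2) auto
      also have "\<dots> = B"
        using \<open>1 \<le> r\<close> \<open>0 \<le> B\<close> by (simp add: powr_powr)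
      finally show ?thesis
        using False \<open>I \<noteq> \<infinity>\<close>
        by (simp add: Lp_norm_real_def Let_def flip: I_def r_def) (rule ennreal_leI)
    qed
    then show ?thesis
      by (simp add: g_def[abs_def])
  qed
  then show ?thesis
    unfolding Lp_norm_def by (subst Max_le_iff) auto
qed

section \<open>Continuity and germs\<close>

text \<open>
  The time horizon depends on the growth rate \<open>M\<close> and the input only, not on the constant \<open>K\<close>
  of the series. The condition \<open>T \<le> 1\<close> makes every \<open>L\<^sub>q\<close> norm on \<open>[0, T]\<close> at most the
  supremum norm.
\<close>

lemma CF_horizon:
  fixes u :: "real \<Rightarrow> real ^ 'm::finite"
  assumes "1 \<le> p" "1 \<le> q" "0 < M" "0 < t1" and u: "u \<in> Lp p 0 t1"
  obtains T where "0 < T" "T \<le> t1" "T \<le> 1"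
    and "\<And>(c :: ('m, 'l::finite) series) K. 0 \<le> K \<Longrightarrow>
      (\<And>\<eta>. infnorm (c \<eta>) \<le> K * M ^ length \<eta> * fact (length \<eta>)) \<Longrightarrow>
      CF_converges_on {0..T} c u \<and> CF c u \<in> Lp q 0 T \<and>
      (\<forall>t\<in>{0..T}. norm (CF c u t) \<le> 2 * sqrt CARD('l) * K)"
proof -
  let ?S = "\<lambda>t. integral {0..t} (input_weight u)"
  have int: "input u x absolutely_integrable_on {0..t1}" for x
    by (rule absolutely_integrable_input[OF \<open>1 \<le> p\<close> u])
  have "continuous_on {0..t1} ?S"
    by (intro indefinite_integral_continuous_1 set_lebesgue_integral_eq_integral(1)
        absolutely_integrable_input_weight int)
  then obtain d where "d > 0"
    and d: "\<And>t. t \<in> {0..t1} \<Longrightarrow> \<bar>t\<bar> < d \<Longrightarrow> \<bar>?S t\<bar> < 1 / (2 * M)"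
    using \<open>0 < t1\<close> \<open>0 < M\<close> unfolding continuous_on_iff dist_real_def
    by (elim ballE[where x = 0] allE[where x = "1 / (2 * M)"]) auto
  define T where "T = min (min t1 1) (d / 2)"
  have T: "0 < T" "T \<le> t1" "T \<le> 1" "T < d"
    using \<open>d > 0\<close> \<open>0 < t1\<close> by (auto simp: T_def)
  have "?S T < 1 / (2 * M)"
    using d[of T] T by auto
  then have small: "M * ?S T \<le> 1 / 2"
    using \<open>0 < M\<close> by (simp add: field_simps)
  have int_T: "input u x absolutely_integrable_on {0..T}" for x
    using absolutely_integrable_on_subinterval[OF int] T by auto
  show thesis
  proof (rule that[OF T(1-3)])
    fix c :: "('m, 'l) series" and K :: real
    assume "0 \<le> K" and c: "\<And>\<eta>. infnorm (c \<eta>) \<le> K * M ^ length \<eta> * fact (length \<eta>)"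
    define K' where "K' = sqrt CARD('l) * K"
    have "0 \<le> K'"
      using \<open>0 \<le> K\<close> by (simp add: K'_def)
    have c': "norm (c \<eta>) \<le> K' * M ^ length \<eta> * fact (length \<eta>)" for \<eta>
    proof -
      have "norm (c \<eta>) \<le> sqrt CARD('l) * infnorm (c \<eta>)"
        using norm_le_infnorm[of "c \<eta>"] by simp
      also have "\<dots> \<le> sqrt CARD('l) * (K * M ^ length \<eta> * fact (length \<eta>))"
        by (intro mult_left_mono c) simp
      finally show ?thesis
        by (simp add: K'_def mult.assoc)
    qed
    note bound = CF_bound[OF int_T c' \<open>0 \<le> K'\<close> \<open>0 < M\<close> small]
    have conv: "CF_converges_on {0..T} c u"
      unfolding CF_converges_on_def using bound(1) abs_summable_summable by blast
    have meas: "CF c u \<in> borel_measurable (lebesgue_on {0..T})"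
      by (rule borel_measurable_CF[OF int_T conv])
    have "Lp_norm q 0 T (CF c u) \<le> ennreal (2 * K')"
      using T bound(2) by (intro Lp_norm_le_bound[OF \<open>1 \<le> q\<close> _ _ meas]) auto
    then have "CF c u \<in> Lp q 0 T"
      using meas le_less_trans[OF _ ennreal_less_top] by (auto simp: Lp_def)
    then show "CF_converges_on {0..T} c u \<and> CF c u \<in> Lp q 0 T \<and>
        (\<forall>t\<in>{0..T}. norm (CF c u t) \<le> 2 * sqrt CARD('l) * K)"
      using conv bound(2) by (simp add: K'_def mult.assoc)
  qed
qed

lemma CF_diff:
  assumes "CF_converges_on {t} c u" "CF_converges_on {t} d u"
  shows "CF (\<lambda>\<eta>. d \<eta> - c \<eta>) u t = CF d u t - CF c u t"
proof -
  have "(CF_term d u t has_sum CF d u t) UNIV" "(CF_term c u t has_sum CF c u t) UNIV"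
    using assms by (auto simp: CF_converges_on_def CF_def)
  then have "((\<lambda>\<eta>. CF_term d u t \<eta> + - CF_term c u t \<eta>) has_sum (CF d u t + - CF c u t)) UNIV"
    by (intro has_sum_add) (simp_all add: has_sum_uminus)
  then show ?thesis
    unfolding CF_def by (intro infsumI) (simp add: CF_term_def[abs_def] scaleR_diff_right)
qed

lemma infnorm_le_linf_norm:
  assumes "0 < M" and "linf_norm M c \<le> ennreal K" "0 \<le> K"
  shows "infnorm (c \<eta>) \<le> K * M ^ length \<eta> * fact (length \<eta>)"
proof -
  have "ennreal (infnorm (c \<eta>) / (M ^ length \<eta> * fact (length \<eta>))) \<le> ennreal K"
    using assms(2) unfolding linf_norm_def by (meson SUP_upper UNIV_I order_trans)
  then have "infnorm (c \<eta>) / (M ^ length \<eta> * fact (length \<eta>)) \<le> K"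
    using \<open>0 \<le> K\<close> by (simp add: ennreal_le_iff)
  then show ?thesis
    using \<open>0 < M\<close> by (simp add: pos_divide_le_eq mult.assoc)
qed

lemma self_in_germ: "u \<in> germ t0 u"
  by (auto simp: germ_def intro: exI[of _ 1])

lemma germ_eqI:
  assumes "0 < d" and "\<And>t. t \<in> {t0..<t0 + d} \<Longrightarrow> u t = v t"
  shows "germ t0 u = germ t0 v"
proof -
  have "germ t0 f \<subseteq> germ t0 g" if fg: "\<And>t. t \<in> {t0..<t0 + d} \<Longrightarrow> f t = g t" for f g :: "real \<Rightarrow> 'a"
  proof
    fix h assume "h \<in> germ t0 f"
    then obtain e where "e > 0" "\<forall>t\<in>{t0..<t0 + e}. h t = f t"
      by (auto simp: germ_def)
    then show "h \<in> germ t0 g"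
      using \<open>0 < d\<close> fg unfolding germ_def by (auto intro!: exI[of _ "min d e"])
  qed
  then show ?thesis
    using assms(2) by (metis subset_antisym)
qed

lemma germ_CF_cong:
  assumes "germ 0 u = germ 0 v"
  shows "germ 0 (CF c u) = germ 0 (CF c v)"
proof -
  have "u \<in> germ 0 v"
    using assms self_in_germ by blast
  then obtain d where "d > 0" and d: "\<And>t. t \<in> {0..<d} \<Longrightarrow> u t = v t"
    by (auto simp: germ_def)
  have "CF c u t = CF c v t" if "t \<in> {0..<d}" for t
    using that by (intro CF_cong d) auto
  then show ?thesis
    using \<open>d > 0\<close> by (intro germ_eqI[of d]) auto
qed

theorem theorem4p1:
  fixes p q :: ennreal
  assumes "1 \<le> p" and "1 \<le> q" and "1 / p + 1 / q = 1"
  shows "(\<exists>!\<Phi> :: (real \<Rightarrow> real ^ 'm::finite) set \<times> ('m, 'l::finite) series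
                    \<Rightarrow> (real \<Rightarrow> real ^ 'l) set.
            \<Phi> \<in> (Lp_germs p 0 \<times> LC) \<rightarrow>\<^sub>E Lp_germs q 0 \<and>
            (\<forall>t1>0. \<forall>u\<in>Lp p 0 t1. \<forall>c\<in>LC.
               (\<exists>T>0. T \<le> t1 \<and> CF_converges_on {0..T} c u \<and> CF c u \<in> Lp q 0 T) \<and>
               \<Phi> (germ 0 u, c) = germ 0 (CF c u)))
       \<and> (\<forall>M>0. \<forall>t1>0. \<forall>u\<in>Lp p 0 t1 :: (real \<Rightarrow> real ^ 'm) set.
            \<exists>T>0. T \<le> t1 \<and>
              (\<forall>c\<in>(linf M :: ('m, 'l) series set).
                 CF_converges_on {0..T} c u \<and> CF c u \<in> Lp q 0 T) \<and>
              norm_continuous_on (linf M :: ('m, 'l) series set)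
                (linf_norm M) (Lp_norm q 0 T) (\<lambda>c. CF c u))"
proof (intro conjI allI impI ballI)
  have local_CF: "\<exists>T>0. T \<le> t1 \<and> CF_converges_on {0..T} c u \<and> CF c u \<in> Lp q 0 T"
    if "0 < t1" "u \<in> Lp p 0 t1" "c \<in> LC"
    for t1 and u :: "real \<Rightarrow> real ^ 'm" and c :: "('m, 'l) series"
  proof -
    obtain K M where KM: "0 \<le> K" "0 < M"
      "\<And>\<eta>. infnorm (c \<eta>) \<le> K * M ^ length \<eta> * fact (length \<eta>)"
      using \<open>c \<in> LC\<close> by (auto simp: LC_def)
    show ?thesis
      using CF_horizon[OF assms(1,2) \<open>0 < M\<close> that(1,2), where 'l = 'l] KM by metis
  qed
  \<comment> \<open>Any representative will do: the output germ depends only on the input germ.\<close>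
  define \<Phi> :: "(real \<Rightarrow> real ^ 'm) set \<times> ('m, 'l) series \<Rightarrow> (real \<Rightarrow> real ^ 'l) set" where
    "\<Phi> = restrict (\<lambda>(g, c). germ 0 (CF c (SOME u. germ 0 u = g))) (Lp_germs p 0 \<times> LC)"
  have germ_in: "germ 0 u \<in> Lp_germs p 0" if "0 < t1" "u \<in> Lp p 0 t1"
    for t1 and u :: "real \<Rightarrow> real ^ 'm"
    using that by (auto simp: Lp_germs_def)
  have \<Phi>_germ: "\<Phi> (germ 0 u, c) = germ 0 (CF c u)"
    if "0 < t1" "u \<in> Lp p 0 t1" "c \<in> LC" for t1 u c
  proof -
    have "germ 0 (SOME v. germ 0 v = germ 0 u) = germ 0 u"
      by (rule someI[of "\<lambda>v. germ 0 v = germ 0 u"]) simp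
    then have "germ 0 (CF c (SOME v. germ 0 v = germ 0 u)) = germ 0 (CF c u)"
      by (rule germ_CF_cong)
    then show ?thesis
      using germ_in[OF that(1,2)] \<open>c \<in> LC\<close> by (simp add: \<Phi>_def)
  qed
  show "\<exists>!\<Phi> :: (real \<Rightarrow> real ^ 'm) set \<times> ('m, 'l) series \<Rightarrow> (real \<Rightarrow> real ^ 'l) set.
      \<Phi> \<in> (Lp_germs p 0 \<times> LC) \<rightarrow>\<^sub>E Lp_germs q 0 \<and>
      (\<forall>t1>0. \<forall>u\<in>Lp p 0 t1. \<forall>c\<in>LC.
         (\<exists>T>0. T \<le> t1 \<and> CF_converges_on {0..T} c u \<and> CF c u \<in> Lp q 0 T) \<and>
         \<Phi> (germ 0 u, c) = germ 0 (CF c u))"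
  proof (rule ex1I[of _ \<Phi>], intro conjI allI impI ballI)
    show "\<Phi> \<in> (Lp_germs p 0 \<times> LC) \<rightarrow>\<^sub>E Lp_germs q 0"
    proof (rule PiE_I)
      fix gc assume "gc \<in> (Lp_germs p 0 :: (real \<Rightarrow> real ^ 'm) set set) \<times> (LC :: ('m, 'l) series set)"
      then obtain t1 u c where *: "gc = (germ 0 u, c)" "0 < t1" "u \<in> Lp p 0 t1" "c \<in> LC"
        by (auto simp: Lp_germs_def)
      show "\<Phi> gc \<in> Lp_germs q 0"
        using \<Phi>_germ[OF *(2-4)] local_CF[OF *(2-4)] *(1) by (auto simp: Lp_germs_def)
    qed (auto simp: \<Phi>_def)
  next
    fix \<Psi> :: "(real \<Rightarrow> real ^ 'm) set \<times> ('m, 'l) series \<Rightarrow> (real \<Rightarrow> real ^ 'l) set"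
    assume \<Psi>: "\<Psi> \<in> (Lp_germs p 0 \<times> LC) \<rightarrow>\<^sub>E Lp_germs q 0 \<and>
      (\<forall>t1>0. \<forall>u\<in>Lp p 0 t1. \<forall>c\<in>LC.
         (\<exists>T>0. T \<le> t1 \<and> CF_converges_on {0..T} c u \<and> CF c u \<in> Lp q 0 T) \<and>
         \<Psi> (germ 0 u, c) = germ 0 (CF c u))"
    show "\<Psi> = \<Phi>"
    proof
      fix gc
      show "\<Psi> gc = \<Phi> gc"
      proof (cases "gc \<in> Lp_germs p 0 \<times> LC")
        case True
        then obtain t1 u c where "gc = (germ 0 u, c)" "0 < t1" "u \<in> Lp p 0 t1" "c \<in> LC"
          by (auto simp: Lp_germs_def)
        then show ?thesis
          using \<Psi> \<Phi>_germ by auto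
      next
        case False
        then show ?thesis
          using PiE_arb[OF conjunct1[OF \<Psi>] False] by (simp add: \<Phi>_def del: mem_Sigma_iff)
      qed
    qed
  qed (use local_CF \<Phi>_germ in blast)+
next
  fix M t1 :: real and u :: "real \<Rightarrow> real ^ 'm"
  assume "0 < M" "0 < t1" "u \<in> Lp p 0 t1"
  from CF_horizon[OF assms(1,2) this, where 'l = 'l]
  obtain T where T: "0 < T" "T \<le> t1" "T \<le> 1"
    and CF: "\<And>(c :: ('m, 'l) series) K. 0 \<le> K \<Longrightarrow>
      (\<And>\<eta>. infnorm (c \<eta>) \<le> K * M ^ length \<eta> * fact (length \<eta>)) \<Longrightarrow>
      CF_converges_on {0..T} c u \<and> CF c u \<in> Lp q 0 T \<and>
      (\<forall>t\<in>{0..T}. norm (CF c u t) \<le> 2 * sqrt CARD('l) * K)"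
    by blast
  have conv: "CF_converges_on {0..T} c u \<and> CF c u \<in> Lp q 0 T"
    if "c \<in> linf M" for c :: "('m, 'l) series"
  proof -
    have "linf_norm M c \<le> ennreal (enn2real (linf_norm M c))"
      using that by (simp add: linf_def less_top)
    from CF[OF _ infnorm_le_linf_norm[OF \<open>0 < M\<close> this]] show ?thesis
      by simp
  qed
  have "norm_continuous_on (linf M :: ('m, 'l) series set)
      (linf_norm M) (Lp_norm q 0 T) (\<lambda>c. CF c u)"
    unfolding norm_continuous_on_def
  proof (intro ballI allI impI)
    fix c :: "('m, 'l) series" and \<epsilon> :: real
    assume c: "c \<in> linf M" and "\<epsilon> > 0"
    define L where "L = 2 * sqrt CARD('l)"
    have "0 < L"
      by (simp add: L_def)
    \<comment> \<open>Half of \<open>\<epsilon> / L\<close>, as the bound \<open>L * \<delta>\<close> obtained below is not strict.\<close>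
    define \<delta> where "\<delta> = \<epsilon> / (2 * L)"
    have "0 < \<delta>"
      using \<open>0 < L\<close> \<open>\<epsilon> > 0\<close> by (simp add: \<delta>_def)
    have "Lp_norm q 0 T (\<lambda>s. CF d u s - CF c u s) < ennreal \<epsilon>"
      if d: "d \<in> linf M" and dist: "linf_norm M (\<lambda>\<eta>. d \<eta> - c \<eta>) < ennreal \<delta>"
      for d :: "('m, 'l) series"
    proof -
      have "infnorm (d \<eta> - c \<eta>) \<le> \<delta> * M ^ length \<eta> * fact (length \<eta>)" for \<eta>
        using infnorm_le_linf_norm[OF \<open>0 < M\<close> less_imp_le[OF dist]] \<open>0 < \<delta>\<close> by simp
      from CF[of \<delta> "\<lambda>\<eta>. d \<eta> - c \<eta>", OF less_imp_le[OF \<open>0 < \<delta>\<close>] this]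
      have bound: "norm (CF (\<lambda>\<eta>. d \<eta> - c \<eta>) u s) \<le> L * \<delta>" if "s \<in> {0..T}" for s
        using that by (simp add: L_def)
      have "norm (CF d u s - CF c u s) \<le> L * \<delta>" if s: "s \<in> {0..T}" for s
        using bound[OF s] CF_diff[of s c u d] conv[OF c] conv[OF d] s
        by (simp add: CF_converges_on_def)
      moreover have "(\<lambda>s. CF d u s - CF c u s) \<in> borel_measurable (lebesgue_on {0..T})"
        using conv[OF c] conv[OF d] by (intro borel_measurable_diff) (auto simp: Lp_def)
      ultimately have "Lp_norm q 0 T (\<lambda>s. CF d u s - CF c u s) \<le> ennreal (L * \<delta>)"
        using T by (intro Lp_norm_le_bound[OF assms(2)]) auto
      also have "\<dots> < ennreal \<epsilon>"
        using \<open>0 < L\<close> \<open>\<epsilon> > 0\<close> by (intro ennreal_lessI) (auto simp: \<delta>_def)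
      finally show ?thesis .
    qed
    then show "\<exists>\<delta>>0. \<forall>d\<in>linf M. linf_norm M (\<lambda>x. d x - c x) < ennreal \<delta> \<longrightarrow>
        Lp_norm q 0 T (\<lambda>s. CF d u s - CF c u s) < ennreal \<epsilon>"
      using \<open>0 < \<delta>\<close> by blast
  qed
  with T conv
  show "\<exists>T>0. T \<le> t1 \<and>
      (\<forall>c\<in>(linf M :: ('m, 'l) series set). CF_converges_on {0..T} c u \<and> CF c u \<in> Lp q 0 T) \<and>
      norm_continuous_on (linf M :: ('m, 'l) series set)
        (linf_norm M) (Lp_norm q 0 T) (\<lambda>c. CF c u)"
    by blast
qed

end
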